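(* Let $D\ge 1$, $\lambda>0$, $h>0$, $\phi\in(0,\pi/2]$, and let $\Phi:\mathbb{R}^D\to\mathbb{R}$ be differentiable with $\int_{\mathbb{R}^D}e^{-\Phi(q)}\,dq<\infty$. Let $H(q,p)=\frac{|p|^2}{2}+\Phi(q)$, $\nu(q,p)=e^{-H(q,p)}$, and let $\varphi(q,p)=(q,-p)$ be the momentum flip. Suppose that the integrator $\theta_h:\mathbb{R}^{2D}\to\mathbb{R}^{2D}$ is reversible, i.e. $\theta_h\circ\varphi\circ\theta_h=\varphi$, and volume-preserving, i.e. $\det(D\theta_h)=1$. Then, for all $f\in C_c^\infty(\mathbb{R}^{2D})$, $$\int_{\mathbb{R}^{2D}}L_h^{(2)}f(q,p)\,\nu(q,p)\,dq\,dp=0.$$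
   Context: The map $\theta_h$ is the ($C^1$) one-step map of a numerical integrator for Hamilton's equations $\dot q=p$, $\dot p=-\nabla\Phi(q)$ with time step $h$. $C_c^\infty(\mathbb{R}^{2D})$ is the space of compactly supported smooth real functions. The momentum randomization is $\Gamma(q,p)=(q,\cos(\phi)p+\sin(\phi)\xi)$ with $\xi\sim\mathcal N(0,1)^D$ standard Gaussian. The Metropolis ratio is $\alpha_h(q,p)=1\wedge\frac{\nu(\theta_h(q,p))}{\nu(q,p)}$. The operator $L_h^{(2)}$ is $$\begin{aligned}L_h^{(2)}f(q,p)=\ &\lambda^{-1}\,\mathbb{E}\{f(\Gamma(q,p))-f(q,p)\}+h^{-1}\alpha_h(q,p)\big(f(\theta_h(q,p))-f(q,p)\big)\\&+h^{-1}(1-\alpha_h(q,p))\big(f(\varphi(q,p))-f(q,p)\big),\end{aligned}$$ the expectation being over $\xi$. *)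

theory Defs
  imports "HOL-Probability.Probability"
begin

type_synonym 'd phase = "(real ^ 'd) \<times> (real ^ 'd)"

text \<open>
  \<open>C_k k f\<close>: the function \<open>f\<close> is \<open>k\<close> times continuously differentiable on the whole space.
  In finite dimension, continuity of the derivative as a map into the space of linear maps is
  the same as continuity of every directional derivative, so the recursion runs through the
  directional derivatives.
\<close>

primrec C_k :: "nat \<Rightarrow> ('a::euclidean_space \<Rightarrow> 'b::real_normed_vector) \<Rightarrow> bool" where
  "C_k 0 f \<longleftrightarrow> continuous_on UNIV f"
| "C_k (Suc k) f \<longleftrightarrow>
     (\<forall>x. f differentiable (at x)) \<and> (\<forall>v. C_k k (\<lambda>x. frechet_derivative f (at x) v))"

definition Cc_infinity :: "('a::euclidean_space \<Rightarrow> real) set" where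
  "Cc_infinity = {f. (\<forall>k. C_k k f) \<and> compact (closure {x. f x \<noteq> 0})}"

text \<open>
  The library determinant is for matrices over a finite index type, so phase space is
  identified with \<open>real ^ ('d + 'd)\<close>: index \<open>Inl i\<close> is the \<open>i\<close>-th position coordinate and
  \<open>Inr i\<close> the \<open>i\<close>-th momentum coordinate.
\<close>

definition stack :: "'d::finite phase \<Rightarrow> real ^ ('d + 'd)" where
  "stack z = (\<chi> i. case i of Inl j \<Rightarrow> fst z $ j | Inr j \<Rightarrow> snd z $ j)"

definition unstack :: "real ^ ('d + 'd) \<Rightarrow> 'd::finite phase" where
  "unstack x = (\<chi> j. x $ Inl j, \<chi> j. x $ Inr j)"

definition jacobian_matrix ::
  "('d::finite phase \<Rightarrow> 'd phase) \<Rightarrow> 'd phase \<Rightarrow> real ^ ('d + 'd) ^ ('d + 'd)" where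
  "jacobian_matrix \<theta> z = matrix (stack \<circ> frechet_derivative \<theta> (at z) \<circ> unstack)"

definition volume_preserving :: "('d::finite phase \<Rightarrow> 'd phase) \<Rightarrow> bool" where
  "volume_preserving \<theta> \<longleftrightarrow> (\<forall>z. det (jacobian_matrix \<theta> z) = 1)"

definition flip :: "'d::finite phase \<Rightarrow> 'd phase" where
  "flip = (\<lambda>(q, p). (q, - p))"

definition reversible :: "('d::finite phase \<Rightarrow> 'd phase) \<Rightarrow> bool" where
  "reversible \<theta> \<longleftrightarrow> \<theta> \<circ> flip \<circ> \<theta> = flip"

definition hamiltonian :: "(real ^ 'd \<Rightarrow> real) \<Rightarrow> 'd::finite phase \<Rightarrow> real" where
  "hamiltonian \<Phi> = (\<lambda>(q, p). (norm p)\<^sup>2 / 2 + \<Phi> q)"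

definition nu :: "(real ^ 'd \<Rightarrow> real) \<Rightarrow> 'd::finite phase \<Rightarrow> real" where
  "nu \<Phi> z = exp (- hamiltonian \<Phi> z)"

text \<open>The law of \<open>\<xi>\<close>: the \<open>D\<close>-fold product of the one-dimensional standard normal law.\<close>

definition std_gaussian :: "(real ^ 'd::finite) measure" where
  "std_gaussian =
     distr (\<Pi>\<^sub>M i\<in>(UNIV :: 'd set). density lborel (\<lambda>x. ennreal (std_normal_density x)))
       borel (\<lambda>x. \<chi> i. x i)"

definition randomize :: "real \<Rightarrow> real ^ 'd \<Rightarrow> 'd::finite phase \<Rightarrow> 'd phase" where
  "randomize \<phi> \<xi> = (\<lambda>(q, p). (q, cos \<phi> *\<^sub>R p + sin \<phi> *\<^sub>R \<xi>))"

definition metropolis ::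
  "(real ^ 'd \<Rightarrow> real) \<Rightarrow> ('d::finite phase \<Rightarrow> 'd phase) \<Rightarrow> 'd phase \<Rightarrow> real" where
  "metropolis \<Phi> \<theta> z = min 1 (nu \<Phi> (\<theta> z) / nu \<Phi> z)"

definition L2 ::
  "real \<Rightarrow> real \<Rightarrow> real \<Rightarrow> (real ^ 'd \<Rightarrow> real) \<Rightarrow> ('d::finite phase \<Rightarrow> 'd phase) \<Rightarrow>
    ('d phase \<Rightarrow> real) \<Rightarrow> 'd phase \<Rightarrow> real" where
  "L2 lam h \<phi> \<Phi> \<theta> f z =
     inverse lam * (\<integral>\<xi>. (f (randomize \<phi> \<xi> z) - f z) \<partial>std_gaussian)
     + inverse h * metropolis \<Phi> \<theta> z * (f (\<theta> z) - f z)
     + inverse h * (1 - metropolis \<Phi> \<theta> z) * (f (flip z) - f z)"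

end

theory Submission
  imports Defs
begin

text \<open>
  Multiplied by \<open>\<nu> = nu \<Phi>\<close>, the generator splits into differences of integrable functions with equal
  integrals.

  The momentum refreshment preserves \<open>\<nu>\<close> because, jointly with an independent standard Gaussian \<open>\<xi>\<close>, it
  is the first half of a rotation of \<open>(p, \<xi>)\<close>, which leaves both Lebesgue measure and the density
  \<open>exp (- (\<bar>p\<bar>\<^sup>2 + \<bar>\<xi>\<bar>\<^sup>2) / 2)\<close> unchanged (\<open>momentum_randomization_invariant\<close>).

  For the Metropolis step put \<open>m z = min (\<nu> z) (\<nu> (\<theta> z))\<close>, which is the acceptance ratio times \<open>\<nu>\<close>. With
  rate \<open>1 / h\<close> the step contributes \<open>m (f \<circ> \<theta> - f \<circ> flip) + \<nu> (f \<circ> flip - f)\<close>. The second summand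
  integrates to zero because \<open>flip\<close> preserves \<open>\<nu>\<close> and Lebesgue measure. The first one does because
  \<open>\<theta>\<close> is conjugate to its inverse by \<open>flip\<close> and preserves Lebesgue measure
  (\<open>metropolis_balance\<close>).

  The remaining point is that the pointwise condition on the Jacobian determinant makes \<open>\<theta>\<close> preserve
  Lebesgue measure (\<open>volume_preserving_distr_lborel\<close>). Reversibility makes \<open>\<theta>\<close> bijective, and the
  change of variables formula then applies.
\<close>

section \<open>Maps preserving Lebesgue measure\<close>

lemma distr_lborel_comp:
  fixes f :: "'a::euclidean_space \<Rightarrow> 'b::euclidean_space" and g :: "'b \<Rightarrow> 'c::euclidean_space"
  assumes [measurable]: "f \<in> borel_measurable borel" "g \<in> borel_measurable borel"
    and f: "distr lborel borel f = lborel" and g: "distr lborel borel g = lborel"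
  shows "distr lborel borel (\<lambda>x. g (f x)) = lborel"
proof -
  have "distr lborel borel (\<lambda>x. g (f x)) = distr (distr lborel borel f) borel g"
    by (simp add: distr_distr o_def)
  then show ?thesis
    by (simp add: f g)
qed

lemma lborel_preserving_integral:
  fixes T :: "'a::euclidean_space \<Rightarrow> 'b::euclidean_space" and F :: "'b \<Rightarrow> real"
  assumes T: "T \<in> borel_measurable borel" "distr lborel borel T = lborel"
    and F: "F \<in> borel_measurable borel"
  shows lborel_preserving_integrable_iff: "integrable lborel (\<lambda>z. F (T z)) \<longleftrightarrow> integrable lborel F"
    and lborel_preserving_integral_eq: "(\<integral>z. F (T z) \<partial>lborel) = (\<integral>z. F z \<partial>lborel)"
  using integrable_distr_eq[of T lborel borel F] integral_distr[of T lborel borel F] T F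
  by simp_all

lemma integrable_lborel_prod:
  fixes u :: "'a::euclidean_space \<Rightarrow> real" and v :: "'b::euclidean_space \<Rightarrow> real"
  assumes u: "integrable lborel u" and v: "integrable lborel v"
  shows "integrable lborel (\<lambda>z. u (fst z) * v (snd z))"
proof -
  have [measurable]: "u \<in> borel_measurable borel" "v \<in> borel_measurable borel"
    using u v by (auto dest: borel_measurable_integrable)
  have "integrable (lborel \<Otimes>\<^sub>M lborel) (\<lambda>z. u (fst z) * v (snd z))"
    using u v by (intro lborel_pair.Fubini_integrable) (simp_all add: abs_mult)
  then show ?thesis
    by (simp add: lborel_prod)
qed

text \<open>
  Permuting and regrouping coordinates: the preimage of a box is the box with the permuted
  corners, so that its volume is the same product of side lengths in another order.
\<close>

lemma distr_lborel_Basis_bij: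
  fixes T :: "'a::euclidean_space \<Rightarrow> 'b::euclidean_space"
  assumes lin: "linear T" and bij: "bij_betw T Basis Basis"
  shows "distr lborel borel T = lborel"
proof (rule lborel_eqI[symmetric])
  have [measurable]: "T \<in> borel_measurable borel"
    using lin by (intro borel_measurable_continuous_onI linear_continuous_on)
      (simp add: linear_conv_bounded_linear)
  have inner_T: "T x \<bullet> T b = x \<bullet> b" if "b \<in> Basis" for x b
  proof -
    have "T x = (\<Sum>a\<in>Basis. (x \<bullet> a) *\<^sub>R T a)"
      by (subst euclidean_representation[of x, symmetric])
        (simp add: linear_sum[OF lin] linear_scale[OF lin])
    also have "\<dots> \<bullet> T b = (\<Sum>a\<in>Basis. (if a = b then x \<bullet> a else 0))"
      unfolding inner_sum_left
    proof (intro sum.cong refl)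
      fix a :: 'a
      assume "a \<in> Basis"
      with that bij have "T a \<in> Basis" "T b \<in> Basis" "T a = T b \<longleftrightarrow> a = b"
        by (auto simp: bij_betw_def inj_on_eq_iff)
      then show "(x \<bullet> a) *\<^sub>R T a \<bullet> T b = (if a = b then x \<bullet> a else 0)"
        by (simp add: inner_Basis)
    qed
    also have "\<dots> = x \<bullet> b"
      using that by simp
    finally show ?thesis .
  qed
  have Basis_image: "(\<forall>b\<in>Basis. P b) \<longleftrightarrow> (\<forall>b\<in>Basis. P (T b))" for P
    using bij by (metis bij_betw_def image_eqI imageE)
  fix l u :: 'b
  assume le: "\<And>b. b \<in> Basis \<Longrightarrow> l \<bullet> b \<le> u \<bullet> b"
  \<comment> \<open>\<open>pull\<close> is the adjoint of \<open>T\<close>, which here is its inverse.\<close>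
  define pull where "pull y = (\<Sum>b\<in>Basis. (y \<bullet> T b) *\<^sub>R b)" for y
  have pull: "pull y \<bullet> b = y \<bullet> T b" if "b \<in> Basis" for y b
    using that by (simp add: pull_def)
  have "T -` box l u = box (pull l) (pull u)"
    unfolding box_def by (auto simp: Basis_image inner_T pull)
  moreover have "emeasure lborel (box (pull l) (pull u)) = (\<Prod>b\<in>Basis. (pull u - pull l) \<bullet> b)"
    using le bij by (intro emeasure_lborel_box) (auto simp: pull bij_betw_def)
  moreover have "(\<Prod>b\<in>Basis. (pull u - pull l) \<bullet> b) = (\<Prod>b\<in>Basis. (u - l) \<bullet> T b)"
    by (intro prod.cong) (auto simp: pull inner_diff_left)
  moreover have "\<dots> = (\<Prod>b\<in>Basis. (u - l) \<bullet> b)"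
    by (rule prod.reindex_bij_betw[OF bij])
  ultimately show "emeasure (distr lborel borel T) (box l u) = (\<Prod>b\<in>Basis. (u - l) \<bullet> b)"
    by (simp add: emeasure_distr)
qed simp

text \<open>
  Tonelli reduces the claim to the fibres over the first component. Shears and the momentum flip
  are of this form: on each fibre they are a translation or a reflection.
\<close>

lemma distr_lborel_fibrewise:
  fixes T :: "'a::euclidean_space \<Rightarrow> 'b::euclidean_space \<Rightarrow> 'b"
  assumes meas [measurable]: "(\<lambda>z. T (fst z) (snd z)) \<in> borel_measurable borel"
    and fib: "\<And>x. distr lborel borel (T x) = lborel"
  shows "distr lborel borel (\<lambda>z. (fst z, T (fst z) (snd z))) = lborel"
proof (rule measure_eqI)
  fix A :: "('a \<times> 'b) set"
  assume "A \<in> sets (distr lborel borel (\<lambda>z. (fst z, T (fst z) (snd z))))"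
  then have A [measurable]: "A \<in> sets borel"
    by simp
  let ?G = "\<lambda>z. (fst z, T (fst z) (snd z))"
  have G: "?G \<in> borel_measurable borel"
    using meas by (intro borel_measurable_Pair)
      (auto intro!: borel_measurable_continuous_onI continuous_intros)
  then have G': "?G \<in> lborel \<rightarrow>\<^sub>M borel"
    by simp
  have [measurable]: "(\<lambda>z. T (fst z) (snd z)) \<in> borel \<Otimes>\<^sub>M borel \<rightarrow>\<^sub>M borel"
    using meas by (simp add: borel_prod)
  have Tx [measurable]: "T x \<in> borel_measurable borel" for x
    using measurable_compose[OF _ meas, of "\<lambda>y. (x, y)" borel] by simp
  have A' [measurable]: "A \<in> sets (borel \<Otimes>\<^sub>M borel)"
    using A by (simp only: borel_prod)
  have "emeasure (distr lborel borel (\<lambda>z. (fst z, T (fst z) (snd z)))) A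
      = (\<integral>\<^sup>+z. indicator A (fst z, T (fst z) (snd z)) \<partial>lborel)"
    using G nn_integral_distr[OF G', of "indicator A"] nn_integral_indicator[of A "distr lborel borel ?G"]
    by simp
  also have "\<dots> = (\<integral>\<^sup>+z. indicator A (fst z, T (fst z) (snd z)) \<partial>(lborel \<Otimes>\<^sub>M lborel))"
    by (simp add: lborel_prod)
  also have "\<dots> = (\<integral>\<^sup>+x. \<integral>\<^sup>+y. indicator A (x, T x y) \<partial>lborel \<partial>lborel)"
    by (subst lborel.nn_integral_fst[symmetric]) simp_all
  also have "\<dots> = (\<integral>\<^sup>+x. \<integral>\<^sup>+y. indicator A (x, y) \<partial>lborel \<partial>lborel)"
  proof (rule nn_integral_cong)
    fix x
    have "(\<integral>\<^sup>+y. indicator A (x, y) \<partial>lborel) = (\<integral>\<^sup>+y. indicator A (x, y) \<partial>distr lborel borel (T x))"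
      by (simp add: fib)
    then show "(\<integral>\<^sup>+y. indicator A (x, T x y) \<partial>lborel) = (\<integral>\<^sup>+y. indicator A (x, y) \<partial>lborel)"
      by (simp add: nn_integral_distr)
  qed
  also have "\<dots> = emeasure (lborel \<Otimes>\<^sub>M lborel) A"
    by (subst lborel.nn_integral_fst) simp_all
  finally show "emeasure (distr lborel borel (\<lambda>z. (fst z, T (fst z) (snd z)))) A = emeasure lborel A"
    by (simp add: lborel_prod)
qed simp

lemma distr_lborel_swap:
  "distr lborel borel (\<lambda>z. (snd z, fst z)) = (lborel :: ('b::euclidean_space \<times> 'a::euclidean_space) measure)"
proof (rule distr_lborel_Basis_bij)
  show "linear (\<lambda>z. (snd z, fst z) :: 'b \<times> 'a)"
    by (rule linearI) auto
  show "bij_betw (\<lambda>z :: 'a \<times> 'b. (snd z, fst z)) Basis Basis"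
    by (rule bij_betw_byWitness[where f' = "\<lambda>z. (snd z, fst z)"]) (auto simp: Basis_prod_def)
qed

lemma distr_lborel_shear_snd:
  fixes S :: "'a::euclidean_space \<Rightarrow> 'b::euclidean_space"
  assumes [measurable]: "S \<in> borel_measurable borel"
  shows "distr lborel borel (\<lambda>z. (fst z, snd z + S (fst z))) = lborel"
proof -
  have fst [measurable]: "fst \<in> borel_measurable (borel :: ('a \<times> 'b) measure)"
    and snd [measurable]: "snd \<in> borel_measurable (borel :: ('a \<times> 'b) measure)"
    by (intro borel_measurable_continuous_onI continuous_intros)+
  show ?thesis
    by (rule distr_lborel_fibrewise) (simp_all add: lborel_distr_plus add.commute[of _ "S _"])
qed

lemma distr_lborel_shear_fst:
  fixes S :: "'b::euclidean_space \<Rightarrow> 'a::euclidean_space"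
  assumes [measurable]: "S \<in> borel_measurable borel"
  shows "distr lborel borel (\<lambda>z. (fst z + S (snd z), snd z)) = lborel"
proof -
  let ?swap = "\<lambda>z :: 'a \<times> 'b. (snd z, fst z)" and ?swap' = "\<lambda>z :: 'b \<times> 'a. (snd z, fst z)"
  let ?sh = "\<lambda>z :: 'b \<times> 'a. (fst z, snd z + S (fst z))"
  have [measurable]: "?swap \<in> borel_measurable borel" "?swap' \<in> borel_measurable borel"
    by (intro borel_measurable_continuous_onI continuous_intros)+
  have fst [measurable]: "fst \<in> borel_measurable (borel :: ('b \<times> 'a) measure)"
    and snd [measurable]: "snd \<in> borel_measurable (borel :: ('b \<times> 'a) measure)"
    by (intro borel_measurable_continuous_onI continuous_intros)+
  have [measurable]: "?sh \<in> borel_measurable borel"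
    by (intro borel_measurable_Pair) measurable
  have "distr lborel borel (\<lambda>z. ?sh (?swap z)) = lborel"
    by (rule distr_lborel_comp[of ?swap ?sh]) (simp_all add: distr_lborel_swap distr_lborel_shear_snd)
  moreover have "(\<lambda>z. ?sh (?swap z)) \<in> borel_measurable borel"
    by (rule measurable_compose[of ?swap _ borel]) measurable
  ultimately have "distr lborel borel (\<lambda>z. ?swap' (?sh (?swap z))) = lborel"
    by (intro distr_lborel_comp[of "\<lambda>z. ?sh (?swap z)" ?swap']) (simp_all add: distr_lborel_swap)
  then show ?thesis
    by simp
qed

text \<open>
  A rotation of the plane is a product of three shears,
  \<open>(p, \<xi>) \<mapsto> (p + t \<xi>, \<xi>)\<close>, then \<open>(p, \<xi>) \<mapsto> (p, \<xi> - sin \<phi> p)\<close>, then the first one again, with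
  \<open>t = (1 - cos \<phi>) / sin \<phi> = tan (\<phi> / 2)\<close>. The factorization turns the invariance of Lebesgue measure
  under this rotation of \<open>(p, \<xi>)\<close> into translation invariance.
\<close>

lemma distr_lborel_momentum_rotation:
  fixes \<phi> :: real
  assumes "sin \<phi> \<noteq> 0"
  defines "R \<equiv> \<lambda>((q :: 'a::euclidean_space, p :: 'b::euclidean_space), \<xi> :: 'b).
    ((q, cos \<phi> *\<^sub>R p + sin \<phi> *\<^sub>R \<xi>), cos \<phi> *\<^sub>R \<xi> - sin \<phi> *\<^sub>R p)"
  shows "distr lborel borel R = lborel"
proof -
  define t where "t = (1 - cos \<phi>) / sin \<phi>"
  define A :: "('a \<times> 'b) \<times> 'b \<Rightarrow> ('a \<times> 'b) \<times> 'b" where "A z = (fst z + (0, t *\<^sub>R snd z), snd z)" for z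
  define B :: "('a \<times> 'b) \<times> 'b \<Rightarrow> ('a \<times> 'b) \<times> 'b"
    where "B z = (fst z, snd z + (- sin \<phi>) *\<^sub>R snd (fst z))" for z
  have [measurable]: "A \<in> borel_measurable borel" "B \<in> borel_measurable borel"
    unfolding A_def B_def by (intro borel_measurable_continuous_onI continuous_intros)+
  have A: "distr lborel borel A = lborel"
    unfolding A_def by (intro distr_lborel_shear_fst borel_measurable_continuous_onI continuous_intros)
  have B: "distr lborel borel B = lborel"
    unfolding B_def by (intro distr_lborel_shear_snd borel_measurable_continuous_onI continuous_intros)
  have ts: "t * sin \<phi> = 1 - cos \<phi>"
    using assms by (simp add: t_def)
  have "t * (1 + cos \<phi>) = (1 - (cos \<phi>)\<^sup>2) / sin \<phi>"
    by (simp add: t_def field_simps power2_eq_square)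
  also have "\<dots> = sin \<phi>"
    using \<open>sin \<phi> \<noteq> 0\<close> by (simp add: sin_squared_eq[symmetric]) (simp add: power2_eq_square)
  finally have t2: "t * (1 + cos \<phi>) = sin \<phi>" .
  have "R z = A (B (A z))" for z
  proof -
    obtain q p \<xi> where z: "z = ((q, p), \<xi>)"
      by (metis prod.exhaust)
    have a: "\<xi> + - sin \<phi> *\<^sub>R (p + t *\<^sub>R \<xi>) = cos \<phi> *\<^sub>R \<xi> - sin \<phi> *\<^sub>R p"
    proof -
      have "\<xi> + - sin \<phi> *\<^sub>R (p + t *\<^sub>R \<xi>) = (1 - t * sin \<phi>) *\<^sub>R \<xi> - sin \<phi> *\<^sub>R p"
        by (simp add: algebra_simps)
      then show ?thesis by (simp add: ts)
    qed
    have "p + t *\<^sub>R \<xi> + t *\<^sub>R (cos \<phi> *\<^sub>R \<xi> - sin \<phi> *\<^sub>R p)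
        = (1 - t * sin \<phi>) *\<^sub>R p + (t * (1 + cos \<phi>)) *\<^sub>R \<xi>"
      by (simp add: algebra_simps)
    then have b: "p + t *\<^sub>R \<xi> + t *\<^sub>R (cos \<phi> *\<^sub>R \<xi> - sin \<phi> *\<^sub>R p) = cos \<phi> *\<^sub>R p + sin \<phi> *\<^sub>R \<xi>"
      by (simp only: ts t2) simp
    show ?thesis
      using a b by (simp add: z R_def A_def B_def)
  qed
  then have "distr lborel borel R = distr (distr (distr lborel borel A) borel B) borel A"
    by (simp add: distr_distr o_def fun_eq_iff[of R] cong: distr_cong)
  then show ?thesis
    by (simp add: A B)
qed

lemma distr_lborel_flip: "distr lborel borel flip = (lborel :: 'd::finite phase measure)"
proof -
  have minus: "distr lborel borel uminus = (lborel :: (real ^ 'd) measure)"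
    using lborel_affine[of "-1" "0 :: real ^ 'd"] by (simp add: density_1)
  have "distr lborel borel (\<lambda>z :: 'd phase. (fst z, - snd z)) = lborel"
    by (intro distr_lborel_fibrewise borel_measurable_continuous_onI continuous_intros)
      (simp add: minus)
  then show ?thesis
    by (simp add: flip_def case_prod_unfold)
qed

section \<open>Bijections with unit Jacobian determinant\<close>

text \<open>
  Conjugation by \<open>s\<close> takes the transposition of \<open>a\<close> and \<open>b\<close> to that of \<open>s a\<close> and \<open>s b\<close>, and so keeps
  the parity of a product of transpositions.
\<close>

lemma sign_conjugate_bij:
  fixes s :: "'m::finite \<Rightarrow> 'n::finite"
  assumes s: "bij s" and p: "p permutes UNIV"
  shows "sign (s \<circ> p \<circ> inv s) = sign p"
  using p finite
proof (induction rule: permutes_induct)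
  case id
  have "s \<circ> id \<circ> inv s = id"
    using s by (simp add: fun_eq_iff bij_is_surj surj_f_inv_f)
  then show ?case by (simp only: sign_id)
next
  case (swap a b p)
  have conj: "s \<circ> (Transposition.transpose a b \<circ> p) \<circ> inv s = Transposition.transpose (s a) (s b) \<circ> (s \<circ> p \<circ> inv s)"
    using s by (auto simp: fun_eq_iff Transposition.transpose_def bij_is_inj inj_eq)
  have perm: "permutation (s \<circ> p \<circ> inv s)" "permutation p"
    using s swap.hyps by (auto simp: permutation bij_comp bij_imp_bij_inv permutes_bij)
  have "s a \<noteq> s b \<longleftrightarrow> a \<noteq> b"
    using s by (simp add: bij_is_inj inj_eq)
  then show ?case
    unfolding conj using perm swap.IH swap.hyps
    by (simp add: sign_compose permutation_swap_id sign_swap_id del: o_apply comp_apply)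
qed

text \<open>
  The Leibniz sums of the two matrices are matched by conjugating permutations with \<open>s\<close>. The index
  types may differ, so this is more than a permutation of rows and columns.
\<close>

lemma det_reindex:
  fixes A :: "'a::comm_ring_1 ^ 'n::finite ^ 'n" and s :: "'m::finite \<Rightarrow> 'n"
  assumes s: "bij s"
  shows "det (\<chi> i j. A $ s i $ s j) = det A"
proof -
  have "det A = (\<Sum>q | q permutes (UNIV :: 'n set). of_int (sign q) * (\<Prod>i\<in>UNIV. A $ i $ q i))"
    by (simp add: det_def)
  also have "\<dots> = (\<Sum>p | p permutes (UNIV :: 'm set).
      of_int (sign (s \<circ> p \<circ> inv s)) * (\<Prod>i\<in>UNIV. A $ i $ (s \<circ> p \<circ> inv s) i))"
  proof (rule sum.reindex_bij_witness[of _ "\<lambda>p. s \<circ> p \<circ> inv s" "\<lambda>q. inv s \<circ> q \<circ> s"])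
    have cancel: "s \<circ> (inv s \<circ> q \<circ> s) \<circ> inv s = q" for q
      using s by (simp add: fun_eq_iff bij_is_surj surj_f_inv_f)
    then show "s \<circ> (inv s \<circ> q \<circ> s) \<circ> inv s = q" for q .
    show "of_int (sign (s \<circ> (inv s \<circ> q \<circ> s) \<circ> inv s)) *
        (\<Prod>i\<in>UNIV. A $ i $ (s \<circ> (inv s \<circ> q \<circ> s) \<circ> inv s) i)
        = of_int (sign q) * (\<Prod>i\<in>UNIV. A $ i $ q i)" for q
      by (simp only: cancel)
    have perm: "p permutes UNIV \<longleftrightarrow> bij p" for p :: "'x \<Rightarrow> 'x"
      by (auto intro: permutes_bij bij_imp_permutes)
    show "inv s \<circ> q \<circ> s \<in> {p. p permutes UNIV}" if "q \<in> {q. q permutes UNIV}" for q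
      using that s by (simp add: perm bij_comp bij_imp_bij_inv)
    show "s \<circ> p \<circ> inv s \<in> {q. q permutes UNIV}" if "p \<in> {p. p permutes UNIV}" for p
      using that s by (simp add: perm bij_comp bij_imp_bij_inv)
    show "inv s \<circ> (s \<circ> p \<circ> inv s) \<circ> s = p" for p
      using s by (simp add: fun_eq_iff bij_is_inj)
  qed
  also have "\<dots> = (\<Sum>p | p permutes (UNIV :: 'm set). of_int (sign p) * (\<Prod>i\<in>UNIV. A $ s i $ s (p i)))"
  proof (intro sum.cong refl)
    fix p :: "'m \<Rightarrow> 'm"
    assume "p \<in> {p. p permutes UNIV}"
    then have sgn: "sign (s \<circ> p \<circ> inv s) = sign p"
      using s by (simp add: sign_conjugate_bij)
    have "(\<Prod>i\<in>UNIV. A $ i $ (s \<circ> p \<circ> inv s) i) = (\<Prod>i\<in>UNIV. A $ s i $ (s \<circ> p \<circ> inv s) (s i))"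
      using s by (rule prod.reindex_bij_betw[symmetric])
    then show "of_int (sign (s \<circ> p \<circ> inv s)) * (\<Prod>i\<in>UNIV. A $ i $ (s \<circ> p \<circ> inv s) i)
        = of_int (sign p) * (\<Prod>i\<in>UNIV. A $ s i $ s (p i))"
      using s by (simp add: sgn bij_is_inj)
  qed
  also have "\<dots> = det (\<chi> i j. A $ s i $ s j)"
    by (simp add: det_def)
  finally show ?thesis ..
qed

text \<open>
  It suffices to measure preimages of boxes. The change of variables formula, applied on the
  preimage of a box, equates the volume of its image, which is the box, with the integral of
  \<open>\<bar>det g'\<bar> = 1\<close> over the preimage.
\<close>

lemma distr_lborel_det_1_wellorder:
  fixes g :: "real ^ 'm::{finite,wellorder} \<Rightarrow> real ^ 'm::_"
  assumes bij: "bij g" and der: "\<And>x. (g has_derivative g' x) (at x)"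
    and det: "\<And>x. \<bar>det (matrix (g' x))\<bar> = 1"
  shows "distr lborel borel g = lborel"
proof (rule lborel_eqI[symmetric])
  have meas [measurable]: "g \<in> borel_measurable borel"
    using der by (intro borel_measurable_continuous_onI)
      (meson continuous_at_imp_continuous_on has_derivative_continuous)
  fix l u :: "real ^ 'm::_"
  assume le: "\<And>b. b \<in> Basis \<Longrightarrow> l \<bullet> b \<le> u \<bullet> b"
  define m where "m = (\<Prod>b\<in>Basis. (u - l) \<bullet> b)"
  have m: "emeasure lborel (box l u) = ennreal m"
    unfolding m_def using le by (rule emeasure_lborel_box)
  have "0 \<le> m"
    unfolding m_def using le by (intro prod_nonneg) (auto simp: inner_diff_left)
  have S [measurable]: "g -` box l u \<in> sets borel"
    using measurable_sets_borel[OF meas, of "box l u"] by simp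
  have "g ` (g -` box l u) \<in> lmeasurable \<and> measure lebesgue (g ` (g -` box l u)) = m"
    using bij m \<open>0 \<le> m\<close> by (simp add: bij_is_surj surj_image_vimage_eq measure_def)
  moreover have "g ` (g -` box l u) \<in> lmeasurable \<and> measure lebesgue (g ` (g -` box l u)) = m
      \<longleftrightarrow> ((\<lambda>x. \<bar>det (matrix (g' x))\<bar>) has_integral m) (g -` box l u)"
    using bij by (intro has_measure_differentiable_image)
      (auto intro: has_derivative_at_withinI der inj_on_subset bij_is_inj)
  ultimately have "((\<lambda>x. 1) has_integral m) (g -` box l u)"
    by (simp add: det)
  then show "emeasure (distr lborel borel g) (box l u) = (\<Prod>b\<in>Basis. (u - l) \<bullet> b)"
    using \<open>0 \<le> m\<close> has_integral_iff_emeasure_lborel[OF S, of m] by (simp add: emeasure_distr m_def)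
qed simp

text \<open>
  Renaming the coordinates along \<open>s\<close> reduces this to the well-ordered index type \<open>'m\<close>, where the
  change of variables formula lives: the renaming \<open>R\<close> preserves Lebesgue measure because it permutes
  the standard basis, and it leaves the Jacobian determinant of \<open>g\<close> as it is.
\<close>

lemma distr_lborel_det_1:
  fixes g :: "real ^ 'n::finite \<Rightarrow> real ^ 'n" and s :: "'m::{finite,wellorder} \<Rightarrow> 'n"
  assumes s: "bij s" and bij: "bij g" and der: "\<And>x. (g has_derivative g' x) (at x)"
    and det: "\<And>x. \<bar>det (matrix (g' x))\<bar> = 1"
  shows "distr lborel borel g = lborel"
proof -
  define R :: "real ^ 'n \<Rightarrow> real ^ 'm::_" where "R x = (\<chi> i. x $ s i)" for x
  define R' :: "real ^ 'm::_ \<Rightarrow> real ^ 'n" where "R' y = (\<chi> j. y $ inv s j)" for y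
  have R'R [simp]: "R' (R x) = x" and RR' [simp]: "R (R' y) = y" for x y
    using s by (simp_all add: R_def R'_def vec_eq_iff bij_is_inj bij_is_surj surj_f_inv_f)
  have lin: "linear R" "linear R'"
    by (auto intro!: linearI simp: R_def R'_def vec_eq_iff)
  then have blin: "bounded_linear R" "bounded_linear R'"
    by (simp_all add: linear_conv_bounded_linear)
  have R_axis: "R (axis j 1) = axis (inv s j) 1" and R'_axis: "R' (axis i 1) = axis (s i) 1" for i j
    using s by (auto simp: R_def R'_def vec_eq_iff axis_def bij_is_inj bij_is_surj surj_f_inv_f)
  have bR: "bij_betw R Basis Basis" and bR': "bij_betw R' Basis Basis"
    by (rule bij_betw_byWitness[where f' = R'], auto simp: Basis_vec_def R_axis R'_axis)
      (rule bij_betw_byWitness[where f' = R], auto simp: Basis_vec_def R_axis R'_axis)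
  have [measurable]: "R \<in> borel_measurable borel" "R' \<in> borel_measurable borel"
    using blin by (auto intro!: borel_measurable_continuous_onI linear_continuous_on)
  have [measurable]: "g \<in> borel_measurable borel"
    using der by (intro borel_measurable_continuous_onI)
      (meson continuous_at_imp_continuous_on has_derivative_continuous)
  have "distr lborel borel (\<lambda>y. R (g (R' y))) = lborel"
  proof (rule distr_lborel_det_1_wellorder)
    show "bij (\<lambda>y. R (g (R' y)))"
      by (rule o_bij[of "\<lambda>y. R (inv g (R' y))"])
        (simp_all add: fun_eq_iff bij bij_is_inj bij_is_surj surj_f_inv_f)
    show "((\<lambda>y. R (g (R' y))) has_derivative (\<lambda>v. R (g' (R' y) (R' v)))) (at y)" for y
      using blin by (intro bounded_linear.has_derivative[of R]
          has_derivative_compose[of R' R', OF bounded_linear_imp_has_derivative der])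
    have "matrix (\<lambda>v. R (g' (R' y) (R' v))) = (\<chi> i j. matrix (g' (R' y)) $ s i $ s j)" for y
      by (simp add: matrix_def vec_eq_iff R_def[of "g' _ _"] R'_axis)
    then show "\<bar>det (matrix (\<lambda>v. R (g' (R' y) (R' v))))\<bar> = 1" for y
      using det by (simp add: det_reindex[OF s])
  qed
  moreover have "g = (\<lambda>x. R' (R (g (R' (R x)))))"
    by simp
  ultimately have "distr lborel borel g
      = distr (distr (distr lborel borel R) borel (\<lambda>y. R (g (R' y)))) borel R'"
    by (simp add: distr_distr o_def)
  also have "\<dots> = lborel"
    using \<open>distr lborel borel (\<lambda>y. R (g (R' y))) = lborel\<close>
    by (simp add: distr_lborel_Basis_bij lin bR bR')
  finally show ?thesis .
qed

lemma unstack_stack [simp]: "unstack (stack z) = z"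
  by (simp add: stack_def unstack_def)

lemma stack_unstack [simp]: "stack (unstack x) = x"
  by (auto simp: stack_def unstack_def vec_eq_iff split: sum.split)

lemma linear_stack: "linear stack"
  by (rule linearI) (auto simp: stack_def vec_eq_iff split: sum.split)

lemma linear_unstack: "linear unstack"
  by (rule linearI) (auto simp: unstack_def vec_eq_iff)

lemma stack_in_Basis: "z \<in> Basis \<Longrightarrow> stack z \<in> Basis"
  by (auto simp: Basis_prod_def Basis_vec_def stack_def axis_def vec_eq_iff fun_eq_iff split: sum.split
      intro: exI[of _ "Inl _"] exI[of _ "Inr _"])

lemma unstack_in_Basis: 
  assumes "x \<in> Basis" shows "unstack x \<in> Basis"
proof -
  obtain k where x: "x = axis k 1" using assms by (auto simp: Basis_vec_def)
  have "unstack (axis (Inl i) 1) = (axis i 1, 0)" "unstack (axis (Inr i) 1) = (0, axis i 1)" for i :: 'a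
    by (auto simp: unstack_def axis_def vec_eq_iff)
  then show ?thesis unfolding x by (cases k) (auto simp: Basis_prod_def Basis_vec_def image_iff)
qed

text \<open>
  The determinant in \<open>volume_preserving\<close> is that of \<open>\<theta>\<close> read in the stacked coordinates, so the map
  to which the determinant criterion applies is \<open>stack \<circ> \<theta> \<circ> unstack\<close>.
\<close>

lemma volume_preserving_distr_lborel:
  fixes \<theta> :: "'d::finite phase \<Rightarrow> 'd phase"
  assumes bij: "bij \<theta>" and diff: "\<And>z. \<theta> differentiable (at z)" and vol: "volume_preserving \<theta>"
  shows "distr lborel borel \<theta> = lborel"
proof -
  let ?g = "\<lambda>x. stack (\<theta> (unstack x))"
  have blin: "bounded_linear stack" "bounded_linear unstack"
    using linear_stack linear_unstack by (simp_all add: linear_conv_bounded_linear)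
  have [measurable]: "stack \<in> borel_measurable borel" "unstack \<in> borel_measurable borel"
    using blin by (auto intro!: borel_measurable_continuous_onI linear_continuous_on)
  have [measurable]: "\<theta> \<in> borel_measurable borel"
    using diff by (intro borel_measurable_continuous_onI)
      (simp add: continuous_at_imp_continuous_on differentiable_imp_continuous_within)
  have der: "(\<theta> has_derivative frechet_derivative \<theta> (at z)) (at z)" for z
    using diff by (simp add: frechet_derivative_works[symmetric])
  have bS: "bij_betw stack Basis Basis" and bU: "bij_betw unstack Basis Basis"
    by (rule bij_betw_byWitness[where f' = unstack], auto simp: stack_in_Basis unstack_in_Basis)
      (rule bij_betw_byWitness[where f' = stack], auto simp: stack_in_Basis unstack_in_Basis)
  \<comment> \<open>The numeral type \<open>'d bit0\<close> is well-ordered and has exactly twice as many elements as \<open>'d\<close>.\<close>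
  have "CARD('d bit0) = CARD('d + 'd)"
    by simp
  then obtain s :: "'d bit0 \<Rightarrow> 'd + 'd" where s: "bij s"
    using finite_same_card_bij[of "UNIV :: 'd bit0 set" "UNIV :: ('d + 'd) set"] by auto
  have "distr lborel borel ?g = lborel"
  proof (rule distr_lborel_det_1[OF s])
    show "bij ?g"
      by (rule o_bij[of "\<lambda>x. stack (inv \<theta> (unstack x))"])
        (simp_all add: fun_eq_iff bij bij_is_inj bij_is_surj surj_f_inv_f)
    show "(?g has_derivative (stack \<circ> frechet_derivative \<theta> (at (unstack x)) \<circ> unstack)) (at x)" for x
      unfolding comp_def
      using blin by (intro bounded_linear.has_derivative[of stack]
          has_derivative_compose[of unstack unstack, OF bounded_linear_imp_has_derivative der])
    show "\<bar>det (matrix (stack \<circ> frechet_derivative \<theta> (at (unstack x)) \<circ> unstack))\<bar> = 1" for x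
      using vol unfolding volume_preserving_def jacobian_matrix_def by (metis abs_one)
  qed
  moreover have "distr lborel borel \<theta> = distr (distr (distr lborel borel stack) borel ?g) borel unstack"
    by (simp add: distr_distr o_def)
  ultimately show ?thesis
    by (simp add: distr_lborel_Basis_bij linear_stack linear_unstack bS bU)
qed

section \<open>The Gaussian law\<close>

lemma measurable_vec_lambda:
  "(\<lambda>x. \<chi> i. x i) \<in> (\<Pi>\<^sub>M i\<in>(UNIV :: 'd::finite set). lborel :: real measure) \<rightarrow>\<^sub>M borel"
proof (subst borel_measurable_euclidean_space, intro ballI)
  fix b :: "real ^ 'd"
  assume "b \<in> Basis"
  then obtain i where b: "b = axis i 1"
    by (auto simp: Basis_vec_def)
  show "(\<lambda>x. (\<chi> i. x i) \<bullet> b) \<in> borel_measurable (\<Pi>\<^sub>M i\<in>(UNIV :: 'd set). lborel :: real measure)"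
    by (simp add: b inner_axis)
qed

lemma distr_PiM_lborel_vec:
  "distr (\<Pi>\<^sub>M i\<in>(UNIV :: 'd::finite set). lborel) borel (\<lambda>x. \<chi> i. x i) = (lborel :: (real ^ 'd) measure)"
proof (rule lborel_eqI[symmetric])
  interpret product_sigma_finite "\<lambda>_ :: 'd. lborel :: real measure" ..
  have [measurable]: "(\<lambda>x. \<chi> i. x i) \<in> (\<Pi>\<^sub>M i\<in>(UNIV :: 'd set). lborel :: real measure) \<rightarrow>\<^sub>M borel"
    by (rule measurable_vec_lambda)
  fix l u :: "real ^ 'd"
  assume le: "\<And>b. b \<in> Basis \<Longrightarrow> l \<bullet> b \<le> u \<bullet> b"
  have le': "l $ i \<le> u $ i" for i
    using le[of "axis i 1"] by (simp add: inner_axis)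
  have "(\<lambda>x. \<chi> i. x i) -` box l u \<inter> space (\<Pi>\<^sub>M i\<in>(UNIV :: 'd set). lborel :: real measure)
      = (\<Pi>\<^sub>E i\<in>UNIV. {l $ i <..< u $ i})"
    by (auto simp: mem_box_cart space_PiM PiE_iff)
  then have "emeasure (distr (\<Pi>\<^sub>M i\<in>(UNIV :: 'd set). lborel) borel (\<lambda>x. \<chi> i. x i)) (box l u)
      = (\<Prod>i\<in>UNIV. ennreal (u $ i - l $ i))"
    using le' by (simp add: emeasure_distr emeasure_PiM)
  also have "\<dots> = ennreal (\<Prod>i\<in>UNIV. u $ i - l $ i)"
    using le' by (simp add: prod_ennreal)
  also have "(\<Prod>i\<in>UNIV. u $ i - l $ i) = (\<Prod>b\<in>Basis. (u - l) \<bullet> b)"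
    by (simp add: Basis_vec_def UNION_singleton_eq_range prod.reindex inj_on_def axis_eq_axis inner_axis inner_diff_left)
  finally show "emeasure (distr (\<Pi>\<^sub>M i\<in>(UNIV :: 'd set). lborel) borel (\<lambda>x. \<chi> i. x i)) (box l u)
      = (\<Prod>b\<in>Basis. (u - l) \<bullet> b)" .
qed simp

text \<open>
  Both the product of normal laws and the product of the Lebesgue measures with density the product
  of the normal densities give a rectangle the product of the one-dimensional masses.
\<close>

lemma std_gaussian_density:
  "(std_gaussian :: (real ^ 'd::finite) measure)
    = density lborel (\<lambda>x. ennreal ((1 / sqrt (2 * pi)) ^ CARD('d) * exp (- (norm x)\<^sup>2 / 2)))"
proof -
  let ?n = "\<lambda>x :: real. ennreal (std_normal_density x)"
  let ?P = "\<Pi>\<^sub>M i\<in>(UNIV :: 'd set). lborel :: real measure"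
  let ?N = "\<Pi>\<^sub>M i\<in>(UNIV :: 'd set). density lborel ?n"
  interpret L: product_sigma_finite "\<lambda>_ :: 'd. lborel :: real measure" ..
  interpret prob_space "density lborel ?n"
    by (rule prob_space_normal_density) simp
  interpret N: product_sigma_finite "\<lambda>_ :: 'd. density lborel ?n" ..
  have sets: "sets ?N = sets ?P"
    by (rule sets_PiM_cong) simp_all
  have vec [measurable]: "(\<lambda>x. \<chi> i. x i) \<in> ?P \<rightarrow>\<^sub>M borel"
    by (rule measurable_vec_lambda)
  have dens: "(\<Prod>i\<in>UNIV. ?n (x $ i)) = ennreal ((1 / sqrt (2 * pi)) ^ CARD('d) * exp (- (norm x)\<^sup>2 / 2))"
    for x :: "real ^ 'd"
  proof -
    have "(\<Prod>i\<in>UNIV. std_normal_density (x $ i))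
        = (1 / sqrt (2 * pi)) ^ CARD('d) * exp (\<Sum>i\<in>UNIV. - (x $ i)\<^sup>2 / 2)"
      by (simp add: std_normal_density_def prod.distrib exp_sum prod_dividef power_divide)
    also have "(\<Sum>i\<in>UNIV. - (x $ i)\<^sup>2 / 2) = - (norm x)\<^sup>2 / 2"
      by (simp add: norm_vec_def L2_set_def sum_nonneg sum_negf sum_divide_distrib)
    finally show ?thesis
      by (simp add: prod_ennreal)
  qed
  have dens_meas: "(\<lambda>x :: real ^ 'd. \<Prod>i\<in>UNIV. ?n (x $ i)) \<in> borel_measurable borel"
    unfolding dens by measurable
  have "density ?P (\<lambda>x. \<Prod>i\<in>UNIV. ?n (x i)) = ?N"
  proof (rule N.PiM_eqI)
    show "sets (density ?P (\<lambda>x. \<Prod>i\<in>UNIV. ?n (x i))) = sets ?N"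
      using sets by simp
    fix A :: "'d \<Rightarrow> real set"
    assume "\<And>i. i \<in> UNIV \<Longrightarrow> A i \<in> sets (density lborel ?n)"
    then have A [measurable]: "A i \<in> sets borel" for i
      by simp
    have "emeasure (density ?P (\<lambda>x. \<Prod>i\<in>UNIV. ?n (x i))) (Pi\<^sub>E UNIV A)
        = (\<integral>\<^sup>+x. (\<Prod>i\<in>UNIV. ?n (x i)) * indicator (Pi\<^sub>E UNIV A) x \<partial>?P)"
      by (rule emeasure_density) simp_all
    also have "\<dots> = (\<integral>\<^sup>+x. (\<Prod>i\<in>UNIV. ?n (x i) * indicator (A i) (x i)) \<partial>?P)"
    proof (rule nn_integral_cong)
      fix x :: "'d \<Rightarrow> real"
      have "indicator (Pi\<^sub>E UNIV A) x = (\<Prod>i\<in>UNIV. indicator (A i) (x i) :: ennreal)"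
        by (auto simp: indicator_def PiE_iff prod_eq_1_iff intro!: prod_zero)
      then show "(\<Prod>i\<in>UNIV. ?n (x i)) * indicator (Pi\<^sub>E UNIV A) x
          = (\<Prod>i\<in>UNIV. ?n (x i) * indicator (A i) (x i))"
        by (simp add: prod.distrib)
    qed
    also have "\<dots> = (\<Prod>i\<in>UNIV. \<integral>\<^sup>+x. ?n x * indicator (A i) x \<partial>lborel)"
      by (rule L.product_nn_integral_prod) simp_all
    also have "\<dots> = (\<Prod>i\<in>UNIV. emeasure (density lborel ?n) (A i))"
      by (simp add: emeasure_density)
    finally show "emeasure (density ?P (\<lambda>x. \<Prod>i\<in>UNIV. ?n (x i))) (Pi\<^sub>E UNIV A)
        = (\<Prod>i\<in>UNIV. emeasure (density lborel ?n) (A i))" .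
  qed simp
  then have "std_gaussian = distr (density ?P (\<lambda>x. \<Prod>i\<in>UNIV. ?n (x i))) borel (\<lambda>x. \<chi> i. x i)"
    by (simp add: std_gaussian_def)
  also have "\<dots> = density (distr ?P borel (\<lambda>x. \<chi> i. x i)) (\<lambda>x. \<Prod>i\<in>UNIV. ?n (x $ i))"
    using density_distr[OF dens_meas vec] by simp
  also have "\<dots> = density lborel (\<lambda>x. \<Prod>i\<in>UNIV. ?n (x $ i))"
    by (simp add: distr_PiM_lborel_vec)
  finally show ?thesis
    by (simp only: dens)
qed

lemma prob_space_std_gaussian: "prob_space (std_gaussian :: (real ^ 'd::finite) measure)"
  unfolding std_gaussian_def
proof (rule prob_space.prob_space_distr)
  show "prob_space (\<Pi>\<^sub>M i\<in>(UNIV :: 'd set). density lborel (\<lambda>x. ennreal (std_normal_density x)))"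
    by (intro prob_space_PiM prob_space_normal_density) simp
  have "sets (\<Pi>\<^sub>M i\<in>(UNIV :: 'd set). density lborel (\<lambda>x. ennreal (std_normal_density x)))
      = sets (\<Pi>\<^sub>M i\<in>(UNIV :: 'd set). lborel)"
    by (rule sets_PiM_cong) simp_all
  then show "(\<lambda>x. \<chi> i. x i) \<in> (\<Pi>\<^sub>M i\<in>(UNIV :: 'd set). density lborel (\<lambda>x. ennreal (std_normal_density x))) \<rightarrow>\<^sub>M borel"
    using measurable_vec_lambda by (simp cong: measurable_cong_sets)
qed

lemma integrable_gaussian_kernel: "integrable lborel (\<lambda>x :: real ^ 'd::finite. exp (- (norm x)\<^sup>2 / 2))"
proof -
  let ?c = "(1 / sqrt (2 * pi)) ^ CARD('d)"
  have m: "(\<lambda>x :: real ^ 'd. exp (- (norm x)\<^sup>2 / 2)) \<in> borel_measurable lborel"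
    by measurable
  interpret prob_space "std_gaussian :: (real ^ 'd) measure"
    by (rule prob_space_std_gaussian)
  have "integrable (std_gaussian :: (real ^ 'd) measure) (\<lambda>_. 1 :: real)"
    by simp
  then have "integrable lborel (\<lambda>x :: real ^ 'd. ?c * exp (- (norm x)\<^sup>2 / 2))"
    unfolding std_gaussian_density by (subst (asm) integrable_density) (use m in auto)
  then show ?thesis
    by simp
qed

section \<open>Momentum randomization\<close>

lemma nu_eq: "nu \<Phi> z = exp (- \<Phi> (fst z)) * exp (- (norm (snd z))\<^sup>2 / 2)"
  by (simp add: nu_def hamiltonian_def case_prod_unfold exp_add[symmetric])

lemma integrable_nu:
  fixes \<Phi> :: "real ^ 'd::finite \<Rightarrow> real"
  assumes "integrable lborel (\<lambda>q. exp (- \<Phi> q))"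
  shows "integrable lborel (nu \<Phi>)"
proof -
  have "nu \<Phi> = (\<lambda>z. exp (- \<Phi> (fst z)) * exp (- (norm (snd z))\<^sup>2 / 2))"
    by (rule ext) (rule nu_eq)
  then show ?thesis
    using integrable_lborel_prod[OF assms integrable_gaussian_kernel] by simp
qed

text \<open>
  Write the expectation over \<open>\<xi>\<close> against its Gaussian density \<open>g\<close>. The left integral becomes that of
  \<open>F \<circ> R\<close>, where \<open>F (z, \<xi>) = f z * nu \<Phi> z * g \<xi>\<close> and \<open>R\<close> rotates \<open>(p, \<xi>)\<close> by \<open>\<phi>\<close>: the
  first output of \<open>R\<close> is the randomized state, and \<open>nu \<Phi> z * g \<xi>\<close> depends on \<open>(p, \<xi>)\<close> only
  through \<open>\<bar>p\<bar>\<^sup>2 + \<bar>\<xi>\<bar>\<^sup>2\<close>, which \<open>R\<close> leaves fixed. Since \<open>R\<close> preserves Lebesgue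
  measure, the integral is that of \<open>F\<close>, and integrating out \<open>\<xi>\<close> leaves \<open>f\<close> against \<open>nu \<Phi>\<close>.
\<close>

lemma momentum_randomization_invariant:
  fixes \<Phi> :: "real ^ 'd::finite \<Rightarrow> real" and f :: "'d phase \<Rightarrow> real"
  assumes sin: "sin \<phi> \<noteq> 0" and int: "integrable lborel (\<lambda>q. exp (- \<Phi> q))"
    and f [measurable]: "f \<in> borel_measurable borel" and bound: "\<And>z. \<bar>f z\<bar> \<le> C"
  shows "integrable lborel (\<lambda>z. (\<integral>\<xi>. f (randomize \<phi> \<xi> z) \<partial>std_gaussian) * nu \<Phi> z)" (is ?int)
    and "(\<integral>z. (\<integral>\<xi>. f (randomize \<phi> \<xi> z) \<partial>std_gaussian) * nu \<Phi> z \<partial>lborel) = (\<integral>z. f z * nu \<Phi> z \<partial>lborel)" (is ?eq)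
proof -
  define g where "g x = (1 / sqrt (2 * pi)) ^ CARD('d) * exp (- (norm x)\<^sup>2 / 2)" for x :: "real ^ 'd"
  have gm [measurable]: "g \<in> borel_measurable borel"
    unfolding g_def by measurable
  have g0: "0 \<le> g x" for x
    by (simp add: g_def)
  have dens: "std_gaussian = density lborel (\<lambda>x. ennreal (g x))"
    by (simp add: std_gaussian_density g_def)
  have g_int: "integrable lborel g"
    unfolding g_def using integrable_gaussian_kernel by simp
  interpret prob_space "std_gaussian :: (real ^ 'd) measure"
    by (rule prob_space_std_gaussian)
  have "(\<integral>x. 1 \<partial>(std_gaussian :: (real ^ 'd) measure)) = (\<integral>x. g x * 1 \<partial>lborel)"
    unfolding dens by (subst integral_density) (simp_all add: g0)
  then have g1: "(\<integral>x. g x \<partial>lborel) = 1"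
    by (simp add: prob_space)
  have \<nu>_int: "integrable lborel (nu \<Phi>)"
    using int by (rule integrable_nu)
  then have \<nu>m [measurable]: "nu \<Phi> \<in> borel_measurable borel"
    by (auto dest: borel_measurable_integrable)
  define F where "F w = f (fst w) * nu \<Phi> (fst w) * g (snd w)" for w :: "'d phase \<times> (real ^ 'd)"
  define R :: "'d phase \<times> (real ^ 'd) \<Rightarrow> 'd phase \<times> (real ^ 'd)" where
    "R = (\<lambda>((q, p), \<xi>). ((q, cos \<phi> *\<^sub>R p + sin \<phi> *\<^sub>R \<xi>), cos \<phi> *\<^sub>R \<xi> - sin \<phi> *\<^sub>R p))"
  have R [measurable]: "R \<in> borel_measurable borel" and R_lborel: "distr lborel borel R = lborel"
    unfolding R_def using sin
    by (auto simp: case_prod_unfold intro!: borel_measurable_continuous_onI continuous_intros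
        distr_lborel_momentum_rotation[unfolded case_prod_unfold])
  have f\<nu>_int: "integrable lborel (\<lambda>z. f z * nu \<Phi> z)"
  proof (rule Bochner_Integration.integrable_bound[OF integrable_mult_right[OF \<nu>_int, of C]])
    have "0 \<le> nu \<Phi> z" for z
      by (simp add: nu_def)
    then show "AE z in lborel. norm (f z * nu \<Phi> z) \<le> norm (C * nu \<Phi> z)"
      by (auto simp: abs_mult intro!: AE_I2 mult_right_mono order_trans[OF bound])
  qed simp
  have F_int: "integrable lborel F"
    unfolding F_def using f\<nu>_int g_int by (rule integrable_lborel_prod)
  then have Fm: "F \<in> borel_measurable borel"
    by (auto dest: borel_measurable_integrable)
  have FR: "F (R (z, \<xi>)) = f (randomize \<phi> \<xi> z) * (nu \<Phi> z * g \<xi>)" for z \<xi>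
  proof -
    obtain q p where z: "z = (q, p)"
      by (cases z)
    let ?p = "cos \<phi> *\<^sub>R p + sin \<phi> *\<^sub>R \<xi>" and ?\<xi> = "cos \<phi> *\<^sub>R \<xi> - sin \<phi> *\<^sub>R p"
    have "(norm (c *\<^sub>R p + s *\<^sub>R \<xi>))\<^sup>2 + (norm (c *\<^sub>R \<xi> - s *\<^sub>R p))\<^sup>2
        = (c\<^sup>2 + s\<^sup>2) * ((norm p)\<^sup>2 + (norm \<xi>)\<^sup>2)" for c s :: real
      unfolding power2_norm_eq_inner by (simp add: algebra_simps inner_commute power2_eq_square)
    from this[of "cos \<phi>" "sin \<phi>"] have "(norm ?p)\<^sup>2 + (norm ?\<xi>)\<^sup>2 = (norm p)\<^sup>2 + (norm \<xi>)\<^sup>2"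
      by simp
    then have "exp (- (norm ?p)\<^sup>2 / 2) * exp (- (norm ?\<xi>)\<^sup>2 / 2) = exp (- (norm p)\<^sup>2 / 2) * exp (- (norm \<xi>)\<^sup>2 / 2)"
      by (simp add: exp_add[symmetric] add_divide_distrib[symmetric])
    then show ?thesis
      by (simp add: z F_def R_def randomize_def nu_eq g_def)
  qed
  have FR_int: "integrable (lborel \<Otimes>\<^sub>M lborel) (\<lambda>w. F (R w))"
    using lborel_preserving_integrable_iff[OF R R_lborel Fm] F_int by (simp add: lborel_prod)
  have inner: "(\<integral>\<xi>. f (randomize \<phi> \<xi> z) \<partial>std_gaussian) * nu \<Phi> z = (\<integral>\<xi>. F (R (z, \<xi>)) \<partial>lborel)" for z
  proof -
    have [measurable]: "(\<lambda>\<xi>. f (randomize \<phi> \<xi> z)) \<in> borel_measurable borel"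
      unfolding randomize_def case_prod_unfold
      by (rule measurable_compose[OF _ f], intro borel_measurable_continuous_onI continuous_intros)
    have "(\<integral>\<xi>. f (randomize \<phi> \<xi> z) \<partial>std_gaussian) = (\<integral>\<xi>. g \<xi> * f (randomize \<phi> \<xi> z) \<partial>lborel)"
      unfolding dens by (subst integral_density) (simp_all add: g0)
    then show ?thesis
      by (simp add: FR mult_ac flip: integral_mult_right_zero)
  qed
  show ?int
    unfolding inner using lborel_pair.integrable_fst'[OF FR_int] by simp
  have "(\<integral>z. (\<integral>\<xi>. F (R (z, \<xi>)) \<partial>lborel) \<partial>lborel) = (\<integral>w. F (R w) \<partial>(lborel \<Otimes>\<^sub>M lborel))"
    by (rule lborel_pair.integral_fst'[OF FR_int])
  also have "\<dots> = (\<integral>w. F w \<partial>lborel)"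
    using lborel_preserving_integral_eq[OF R R_lborel Fm] by (simp add: lborel_prod)
  also have "\<dots> = (\<integral>w. F w \<partial>(lborel \<Otimes>\<^sub>M lborel))"
    by (simp add: lborel_prod)
  also have "\<dots> = (\<integral>z. (\<integral>\<xi>. F (z, \<xi>) \<partial>lborel) \<partial>lborel)"
    using F_int by (intro lborel_pair.integral_fst'[symmetric]) (simp add: lborel_prod)
  also have "\<dots> = (\<integral>z. f z * nu \<Phi> z \<partial>lborel)"
    by (simp add: F_def g1)
  finally show ?eq
    unfolding inner .
qed

section \<open>Reversible proposals\<close>

lemma nu_flip [simp]: "nu \<Phi> (flip z) = nu \<Phi> z"
  by (simp add: nu_eq flip_def case_prod_unfold)

lemma flip_flip [simp]: "flip (flip z) = z"
  by (simp add: flip_def case_prod_unfold)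

lemma reversibleD: "reversible \<theta> \<Longrightarrow> \<theta> (flip (\<theta> z)) = flip z"
  unfolding reversible_def by (metis comp_apply)

text \<open>
  Reversibility exhibits the inverse: it is \<open>flip \<circ> \<theta> \<circ> flip\<close>.
\<close>

lemma reversible_bij:
  assumes "reversible \<theta>"
  shows "bij \<theta>"
proof (rule o_bij[of "flip \<circ> \<theta> \<circ> flip"])
  show "\<theta> \<circ> (flip \<circ> \<theta> \<circ> flip) = id" "(flip \<circ> \<theta> \<circ> flip) \<circ> \<theta> = id"
    by (simp_all add: fun_eq_iff reversibleD[OF assms])
qed

text \<open>
  This is detailed balance of the accepted moves, up to a momentum flip. Reversibility lets
  \<open>\<rho> z\<close> be written as \<open>\<rho> (\<theta> (flip (\<theta> z)))\<close>, so that the integrand is a function of \<open>\<theta> z\<close>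
  alone; substituting first along \<open>\<theta>\<close> and then along \<open>flip\<close> gives the right-hand side.
\<close>

lemma metropolis_balance:
  fixes \<theta> :: "'d::finite phase \<Rightarrow> 'd phase" and \<rho> f :: "'d phase \<Rightarrow> real"
  assumes \<theta> [measurable]: "\<theta> \<in> borel_measurable borel" and pres: "distr lborel borel \<theta> = lborel"
    and rev: "reversible \<theta>"
    and \<rho> [measurable]: "\<rho> \<in> borel_measurable borel" and even: "\<And>z. \<rho> (flip z) = \<rho> z"
    and f [measurable]: "f \<in> borel_measurable borel"
  shows "(\<integral>z. min (\<rho> z) (\<rho> (\<theta> z)) * f (\<theta> z) \<partial>lborel)
    = (\<integral>z. min (\<rho> z) (\<rho> (\<theta> z)) * f (flip z) \<partial>lborel)"
proof -
  have flip [measurable]: "flip \<in> borel_measurable borel"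
    unfolding flip_def case_prod_unfold by (intro borel_measurable_continuous_onI continuous_intros)
  note * = reversibleD[OF rev]
  have "(\<integral>z. min (\<rho> z) (\<rho> (\<theta> z)) * f (\<theta> z) \<partial>lborel)
      = (\<integral>z. min (\<rho> (\<theta> (flip (\<theta> z)))) (\<rho> (\<theta> z)) * f (\<theta> z) \<partial>lborel)"
    by (simp add: * even)
  also have "\<dots> = (\<integral>z. min (\<rho> (\<theta> (flip z))) (\<rho> z) * f z \<partial>lborel)"
    by (rule lborel_preserving_integral_eq[OF \<theta> pres, of "\<lambda>z. min (\<rho> (\<theta> (flip z))) (\<rho> z) * f z"]) measurable
  also have "\<dots> = (\<integral>z. min (\<rho> (\<theta> (flip (flip z)))) (\<rho> (flip z)) * f (flip z) \<partial>lborel)"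
    by (rule lborel_preserving_integral_eq[OF flip distr_lborel_flip, symmetric]) measurable
  finally show ?thesis
    by (simp add: even min.commute)
qed

section \<open>Test functions and the generator\<close>

lemma Cc_infinity_continuous:
  assumes "f \<in> Cc_infinity"
  shows "continuous_on UNIV f"
proof -
  have "C_k 0 f"
    using assms unfolding Cc_infinity_def by blast
  then show ?thesis
    by simp
qed

lemma Cc_infinity_bounded:
  assumes f: "f \<in> Cc_infinity"
  obtains C where "\<And>z. \<bar>f z\<bar> \<le> C"
proof -
  let ?K = "closure {z. f z \<noteq> 0}"
  have "compact (f ` ?K)"
    using f Cc_infinity_continuous[OF f]
    by (intro compact_continuous_image) (auto simp: Cc_infinity_def intro: continuous_on_subset)
  then obtain C where C: "\<And>z. z \<in> ?K \<Longrightarrow> \<bar>f z\<bar> \<le> C"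
    by (force dest!: compact_imp_bounded simp: bounded_iff)
  have "\<bar>f z\<bar> \<le> max C 0" for z
    using C[of z] closure_subset[of "{z. f z \<noteq> 0}"] by (cases "f z = 0") auto
  then show ?thesis
    by (rule that)
qed

theorem proposition6p2:
  fixes lam h \<phi> :: real
    and \<Phi> :: "real ^ 'd::finite \<Rightarrow> real"
    and \<theta> :: "'d phase \<Rightarrow> 'd phase"
    and f :: "'d phase \<Rightarrow> real"
  assumes "lam > 0" and "h > 0" and "0 < \<phi>" and "\<phi> \<le> pi / 2"
    and "\<forall>q. \<Phi> differentiable (at q)"
    and "integrable lborel (\<lambda>q. exp (- \<Phi> q))"
    and "C_k 1 \<theta>"
    and "reversible \<theta>"
    and "volume_preserving \<theta>"
    and "f \<in> Cc_infinity"
  shows "integrable lborel (\<lambda>z. L2 lam h \<phi> \<Phi> \<theta> f z * nu \<Phi> z) \<and>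
    (\<integral>z. L2 lam h \<phi> \<Phi> \<theta> f z * nu \<Phi> z \<partial>lborel) = 0"
proof -
  have diff: "\<theta> differentiable (at z)" for z
    using \<open>C_k 1 \<theta>\<close> unfolding One_nat_def C_k.simps by blast
  have \<theta> [measurable]: "\<theta> \<in> borel_measurable borel"
    using diff by (intro borel_measurable_continuous_onI)
      (simp add: continuous_at_imp_continuous_on differentiable_imp_continuous_within)
  have \<theta>_lborel: "distr lborel borel \<theta> = lborel"
    using assms diff by (intro volume_preserving_distr_lborel reversible_bij) auto
  have flip [measurable]: "(flip :: 'd phase \<Rightarrow> _) \<in> borel_measurable borel"
    unfolding flip_def case_prod_unfold by (intro borel_measurable_continuous_onI continuous_intros)
  have fc: "continuous_on UNIV f"
    using \<open>f \<in> Cc_infinity\<close> by (rule Cc_infinity_continuous)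
  then have f [measurable]: "f \<in> borel_measurable borel"
    by (rule borel_measurable_continuous_onI)
  obtain C where C: "\<And>z. \<bar>f z\<bar> \<le> C"
    using Cc_infinity_bounded[OF \<open>f \<in> Cc_infinity\<close>] by blast
  have "sin \<phi> \<noteq> 0"
    using assms by (intro less_imp_neq[symmetric] sin_gt_zero) auto
  note momentum = momentum_randomization_invariant[OF this \<open>integrable lborel (\<lambda>q. exp (- \<Phi> q))\<close> f C]
  have \<nu>_int: "integrable lborel (nu \<Phi>)"
    using assms by (intro integrable_nu)
  then have \<nu> [measurable]: "nu \<Phi> \<in> borel_measurable borel"
    by (auto dest: borel_measurable_integrable)
  have \<nu>_pos: "0 < nu \<Phi> z" for z
    by (simp add: nu_def)
  \<comment> \<open>\<open>m\<close> is the Metropolis ratio times \<open>nu\<close>; in this form the acceptance rule is symmetric in a state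
    and its proposal.\<close>
  define m where "m z = min (nu \<Phi> z) (nu \<Phi> (\<theta> z))" for z
  define A where "A z = (\<integral>\<xi>. f (randomize \<phi> \<xi> z) \<partial>std_gaussian)" for z
  have m [measurable]: "m \<in> borel_measurable borel"
    unfolding m_def by measurable
  \<comment> \<open>The terms other than the momentum expectation are bounded functions times a weight at most \<open>nu\<close>.\<close>
  have int: "integrable lborel (\<lambda>z. w z * f (T z))"
    if w: "w \<in> borel_measurable borel" "\<And>z. 0 \<le> w z" "\<And>z. w z \<le> nu \<Phi> z"
      and T: "T \<in> borel_measurable borel" for w T
  proof (rule Bochner_Integration.integrable_bound[OF integrable_mult_left[OF \<nu>_int, of C]])
    show "(\<lambda>z. w z * f (T z)) \<in> borel_measurable lborel"
      using w(1) T by measurable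
    have "w z * \<bar>f (T z)\<bar> \<le> nu \<Phi> z * C" for z
      using w C by (intro mult_mono) (auto intro: less_imp_le \<nu>_pos)
    then show "AE z in lborel. norm (w z * f (T z)) \<le> norm (nu \<Phi> z * C)"
      using w(2) by (intro AE_I2) (metis abs_ge_self abs_mult abs_of_nonneg order_trans real_norm_def)
  qed
  have int_f: "integrable lborel (\<lambda>z. nu \<Phi> z * f z)"
    by (rule int[where T = "\<lambda>z. z"]) (auto intro: less_imp_le \<nu>_pos)
  have int_flip: "integrable lborel (\<lambda>z. nu \<Phi> z * f (flip z))"
    by (rule int) (auto intro: less_imp_le \<nu>_pos)
  have int_m\<theta>: "integrable lborel (\<lambda>z. m z * f (\<theta> z))"
    and int_mflip: "integrable lborel (\<lambda>z. m z * f (flip z))"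
    by (rule int; auto simp: m_def intro: less_imp_le \<nu>_pos)+
  have int_A: "integrable lborel (\<lambda>z. A z * nu \<Phi> z)"
    unfolding A_def by (rule momentum(1))
  have eq_A: "(\<integral>z. A z * nu \<Phi> z \<partial>lborel) = (\<integral>z. nu \<Phi> z * f z \<partial>lborel)"
    unfolding A_def momentum(2) by (simp add: mult.commute)
  have eq_m: "(\<integral>z. m z * f (\<theta> z) \<partial>lborel) = (\<integral>z. m z * f (flip z) \<partial>lborel)"
    unfolding m_def using assms by (intro metropolis_balance \<theta> \<theta>_lborel \<nu> f) simp_all
  have eq_flip: "(\<integral>z. nu \<Phi> z * f (flip z) \<partial>lborel) = (\<integral>z. nu \<Phi> z * f z \<partial>lborel)"
    using lborel_preserving_integral_eq[OF flip distr_lborel_flip, of "\<lambda>z. nu \<Phi> z * f z"] by simp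
  \<comment> \<open>Each of the three differences on the right integrates to zero, by one of the three identities just shown.\<close>
  have L2: "L2 lam h \<phi> \<Phi> \<theta> f z * nu \<Phi> z = inverse lam * (A z * nu \<Phi> z - nu \<Phi> z * f z)
      + inverse h * (m z * f (\<theta> z) - m z * f (flip z) + (nu \<Phi> z * f (flip z) - nu \<Phi> z * f z))" for z
  proof -
    interpret prob_space "std_gaussian :: (real ^ 'd) measure"
      by (rule prob_space_std_gaussian)
    have sets: "sets (std_gaussian :: (real ^ 'd) measure) = sets borel"
      by (simp add: std_gaussian_def)
    have "(\<lambda>\<xi>. f (randomize \<phi> \<xi> z)) \<in> borel_measurable borel"
      unfolding randomize_def case_prod_unfold
      by (rule measurable_compose[OF _ f], intro borel_measurable_continuous_onI continuous_intros)
    then have "integrable std_gaussian (\<lambda>\<xi>. f (randomize \<phi> \<xi> z))"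
      using C by (intro integrable_const_bound[where B = C]) (auto simp: measurable_cong_sets[OF sets refl])
    then have "(\<integral>\<xi>. (f (randomize \<phi> \<xi> z) - f z) \<partial>std_gaussian) = A z - f z"
      by (simp add: A_def prob_space)
    moreover have "metropolis \<Phi> \<theta> z * nu \<Phi> z = m z"
      using \<nu>_pos[of z] by (simp add: metropolis_def m_def min_mult_distrib_right)
    ultimately show ?thesis
      unfolding L2_def by (simp only: flip: \<open>metropolis \<Phi> \<theta> z * nu \<Phi> z = m z\<close>)
        (simp add: algebra_simps)
  qed
  show ?thesis
    unfolding L2 using int_f int_flip int_m\<theta> int_mflip int_A
    by (simp add: eq_A eq_m eq_flip)
qed

end
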